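(* Let $m,n$ be positive integers and let $a_1,\dots,a_n$ be non-negative integers with $n=a_1+2a_2+\cdots+na_n$. Then the coefficient of $\dfrac{t_1^{a_1}\cdots t_n^{a_n}}{a_1!\cdots a_n!}$ in the expansion of $$\exp\Big(\sum_{\ell\ge 1}\ \sum_{g\in G_m(\ell)}\frac{\ell^{g-1}}{g}\,t_\ell^{g}\Big)$$ is the number of $m$th roots of a permutation of $\{1,\dots,n\}$ of cycle type $\mathbf{a}=(a_1,\dots,a_n)$.
   Context: For positive integers $m,\ell$, define $G_m(\ell)=\{g\in\mathbb{N}:\gcd(g\ell,m)=g\}$ (a finite set), where $\mathbb{N}$ is the set of positive integers. The expression is a formal power series with rational coefficients in the countably many indeterminates $t_1,t_2,\dots$. A permutation has cycle type $(a_1,\dots,a_n)$ if it has exactly $a_i$ cycles of length $i$ for each $i\in\{1,\dots,n\}$ (fixed points being cycles of length 1). An $m$th root of $\sigma\in S_n$ is a permutation $\tau\in S_n$ with $\tau^m=\sigma$; conjugate permutations have the same number of $m$th roots, so the number depends only on the cycle type. *)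

theory Defs
  imports
    Complex_Main
    "HOL-Library.Poly_Mapping"
    "HOL-Combinatorics.Permutations"
    "HOL-Combinatorics.Orbits"
begin

subsection \<open>Formal power series in arbitrarily many indeterminates\<close>

text \<open>
  A monomial is a finitely supported exponent vector \<open>'v \<Rightarrow>\<^sub>0 nat\<close>, where \<open>'v\<close> indexes the
  indeterminates; a power series is an arbitrary family of coefficients indexed by monomials.
\<close>

typedef ('v, 'a) mfps = "UNIV :: (('v \<Rightarrow>\<^sub>0 nat) \<Rightarrow> 'a) set"
  morphisms mfps_coeff Abs_mfps by simp

lemma mfps_coeff_Abs [simp]: "mfps_coeff (Abs_mfps f) = f"
  by (simp add: Abs_mfps_inverse)

lemma mfps_eqI: "(\<And>x. mfps_coeff f x = mfps_coeff g x) \<Longrightarrow> f = g"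
  unfolding mfps_coeff_inject[symmetric] by (rule ext)

definition monom_splits :: "('v \<Rightarrow>\<^sub>0 nat) \<Rightarrow> (('v \<Rightarrow>\<^sub>0 nat) \<times> ('v \<Rightarrow>\<^sub>0 nat)) set" where
  "monom_splits x = {(y, z). y + z = x}"

lemma finite_monom_splits [simp]: "finite (monom_splits x)"
proof -
  let ?M = "Max (insert 0 (Poly_Mapping.lookup x ` Poly_Mapping.keys x))"
  let ?S = "{f. \<forall>v. (v \<in> Poly_Mapping.keys x \<longrightarrow> f v \<in> {..?M}) \<and>
                (v \<notin> Poly_Mapping.keys x \<longrightarrow> f v = (0::nat))}"
  let ?T = "Poly_Mapping.lookup -` ?S"
  have "finite ?S"
    by (rule finite_set_of_finite_funs) simp_all
  then have "finite ?T"
    by (rule finite_vimageI) (rule injI, simp add: lookup_inject)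
  then have "finite (?T \<times> ?T)"
    by simp
  moreover have "y \<in> ?T" if le: "\<forall>v. Poly_Mapping.lookup y v \<le> Poly_Mapping.lookup x v" for y
  proof -
    have "Poly_Mapping.lookup y v \<le> ?M" if "v \<in> Poly_Mapping.keys x" for v
    proof -
      have "Poly_Mapping.lookup x v \<le> ?M"
        by (rule Max_ge) (use that in simp_all)
      then show ?thesis using le[rule_format, of v] by (rule order_trans[rotated])
    qed
    moreover have "Poly_Mapping.lookup y v = 0" if "v \<notin> Poly_Mapping.keys x" for v
    proof -
      have "Poly_Mapping.lookup x v = 0"
        using that by (simp add: in_keys_iff)
      with le show ?thesis by (metis le_zero_eq)
    qed
    ultimately show ?thesis by simp
  qed
  then have "monom_splits x \<subseteq> ?T \<times> ?T"
    unfolding monom_splits_def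
    by (intro subsetI, elim CollectE case_prodE, hypsubst, intro SigmaI) (simp_all only: lookup_add le_add1 le_add2 simp_thms)
  ultimately show ?thesis
    by (rule finite_subset[rotated])
qed

lemma mem_monom_splits_iff: "p \<in> monom_splits x \<longleftrightarrow> fst p + snd p = x"
  by (auto simp: monom_splits_def)

instantiation mfps :: (type, comm_ring_1) comm_ring_1
begin

definition zero_mfps :: "('a, 'b) mfps" where
  "0 = Abs_mfps (\<lambda>_. 0)"

definition one_mfps :: "('a, 'b) mfps" where
  "1 = Abs_mfps (\<lambda>x. if x = 0 then 1 else 0)"

definition plus_mfps :: "('a, 'b) mfps \<Rightarrow> ('a, 'b) mfps \<Rightarrow> ('a, 'b) mfps" where
  "f + g = Abs_mfps (\<lambda>x. mfps_coeff f x + mfps_coeff g x)"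

definition minus_mfps :: "('a, 'b) mfps \<Rightarrow> ('a, 'b) mfps \<Rightarrow> ('a, 'b) mfps" where
  "f - g = Abs_mfps (\<lambda>x. mfps_coeff f x - mfps_coeff g x)"

definition uminus_mfps :: "('a, 'b) mfps \<Rightarrow> ('a, 'b) mfps" where
  "- f = Abs_mfps (\<lambda>x. - mfps_coeff f x)"

definition times_mfps :: "('a, 'b) mfps \<Rightarrow> ('a, 'b) mfps \<Rightarrow> ('a, 'b) mfps" where
  "f * g = Abs_mfps (\<lambda>x. \<Sum>(y, z)\<in>monom_splits x. mfps_coeff f y * mfps_coeff g z)"

lemma mfps_coeff_zero [simp]: "mfps_coeff (0 :: ('a, 'b) mfps) x = 0"
  and mfps_coeff_one: "mfps_coeff (1 :: ('a, 'b) mfps) x = (if x = 0 then 1 else 0)"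
  and mfps_coeff_add [simp]: "mfps_coeff (f + g :: ('a, 'b) mfps) x = mfps_coeff f x + mfps_coeff g x"
  and mfps_coeff_diff [simp]: "mfps_coeff (f - g :: ('a, 'b) mfps) x = mfps_coeff f x - mfps_coeff g x"
  and mfps_coeff_uminus [simp]: "mfps_coeff (- f :: ('a, 'b) mfps) x = - mfps_coeff f x"
  and mfps_coeff_mult: "mfps_coeff (f * g :: ('a, 'b) mfps) x =
        (\<Sum>(y, z)\<in>monom_splits x. mfps_coeff f y * mfps_coeff g z)"
  by (simp_all add: zero_mfps_def one_mfps_def plus_mfps_def minus_mfps_def uminus_mfps_def
      times_mfps_def)

instance
proof
  fix f g h :: "('a, 'b) mfps"
  show "f * g * h = f * (g * h)"
  proof (rule mfps_eqI)
    fix x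
    have "mfps_coeff (f * g * h) x =
        (\<Sum>(p, q)\<in>(SIGMA p:monom_splits x. monom_splits (fst p)).
          mfps_coeff f (fst q) * mfps_coeff g (snd q) * mfps_coeff h (snd p))"
      by (simp add: mfps_coeff_mult case_prod_beta sum_distrib_right sum.Sigma)
    also have "\<dots> = (\<Sum>(p, q)\<in>(SIGMA p:monom_splits x. monom_splits (snd p)).
          mfps_coeff f (fst p) * (mfps_coeff g (fst q) * mfps_coeff h (snd q)))"
      by (rule sum.reindex_bij_witness[where
            i = "\<lambda>((a, bc), (b, c)). ((a + b, c), (a, b))" and
            j = "\<lambda>((ab, c), (a, b)). ((a, b + c), (b, c))"])
        (auto simp: monom_splits_def algebra_simps)
    also have "\<dots> = mfps_coeff (f * (g * h)) x"
      by (simp add: mfps_coeff_mult case_prod_beta sum_distrib_left sum.Sigma)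
    finally show "mfps_coeff (f * g * h) x = mfps_coeff (f * (g * h)) x" .
  qed
  show "f * g = g * f"
  proof (rule mfps_eqI)
    fix x
    show "mfps_coeff (f * g) x = mfps_coeff (g * f) x"
      unfolding mfps_coeff_mult
      by (rule sum.reindex_bij_witness[where i = prod.swap and j = prod.swap])
        (auto simp: monom_splits_def algebra_simps)
  qed
  show "1 * f = f"
  proof (rule mfps_eqI)
    fix x
    have "mfps_coeff (1 * f) x = (\<Sum>p\<in>monom_splits x. if p = (0, x) then mfps_coeff f x else 0)"
      unfolding mfps_coeff_mult
      by (rule sum.cong[OF refl]) (auto simp: case_prod_beta prod_eq_iff mfps_coeff_one mem_monom_splits_iff)
    then show "mfps_coeff (1 * f) x = mfps_coeff f x"
      by (simp add: mem_monom_splits_iff)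
  qed
  show "(f + g) * h = f * h + g * h"
    by (rule mfps_eqI) (simp add: mfps_coeff_mult case_prod_beta distrib_right sum.distrib)
  show "(0 :: ('a, 'b) mfps) \<noteq> 1"
  proof
    assume "(0 :: ('a, 'b) mfps) = 1"
    then have "mfps_coeff (0 :: ('a, 'b) mfps) 0 = mfps_coeff 1 0" by (rule arg_cong)
    then show False by (simp add: mfps_coeff_one)
  qed
  show "- f + f = 0" "f - g = f + - g"
    by (rule mfps_eqI, simp)+
  show "f + g + h = f + (g + h)"
    by (rule mfps_eqI) (simp add: add.assoc)
  show "f + g = g + f"
    by (rule mfps_eqI) (simp add: add.commute)
qed (rule mfps_eqI, simp)+

end

definition mfps_const :: "'a :: zero \<Rightarrow> ('v, 'a) mfps" where
  "mfps_const c = Abs_mfps (\<lambda>x. if x = 0 then c else 0)"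

definition mfps_var :: "'v \<Rightarrow> ('v, 'a :: zero_neq_one) mfps" where
  "mfps_var v = Abs_mfps (\<lambda>x. if x = Poly_Mapping.single v 1 then 1 else 0)"

text \<open>
  Infinite sums of power series are formed coefficientwise. This is the formal sum only for
  locally finite families, i.e. those where every monomial occurs in finitely many summands.
\<close>

definition mfps_locally_finite :: "('i \<Rightarrow> ('v, 'a :: zero) mfps) \<Rightarrow> 'i set \<Rightarrow> bool" where
  "mfps_locally_finite F A \<longleftrightarrow> (\<forall>x. finite {i \<in> A. mfps_coeff (F i) x \<noteq> 0})"

definition mfps_infsum :: "('i \<Rightarrow> ('v, 'a :: comm_monoid_add) mfps) \<Rightarrow> 'i set \<Rightarrow> ('v, 'a) mfps" where
  "mfps_infsum F A =
     Abs_mfps (\<lambda>x. \<Sum>i | i \<in> A \<and> mfps_coeff (F i) x \<noteq> 0. mfps_coeff (F i) x)"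

text \<open>Meaningful for series without constant term, see \<open>mfps_exp_locally_finite\<close> below.\<close>

definition mfps_exp :: "('v, 'a :: field_char_0) mfps \<Rightarrow> ('v, 'a) mfps" where
  "mfps_exp F = mfps_infsum (\<lambda>k. mfps_const (1 / fact k) * F ^ k) UNIV"

lemma mfps_coeff_const_mult [simp]:
  "mfps_coeff (mfps_const c * f) x = c * mfps_coeff f x"
  for c :: "'a :: comm_ring_1" and f :: "('v, 'a) mfps"
proof -
  have "mfps_coeff (mfps_const c * f) x =
      (\<Sum>p\<in>monom_splits x. if p = (0, x) then c * mfps_coeff f x else 0)"
    unfolding mfps_coeff_mult
    by (rule sum.cong[OF refl]) (auto simp: case_prod_beta prod_eq_iff mfps_const_def mem_monom_splits_iff)
  then show ?thesis
    by (simp add: mem_monom_splits_iff)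
qed

lemma mfps_coeff_var_power:
  "mfps_coeff (mfps_var v ^ k) x = (if x = Poly_Mapping.single v k then 1 else 0 :: 'a :: comm_ring_1)"
proof (induction k arbitrary: x)
  case 0
  then show ?case by (simp add: mfps_coeff_one)
next
  case (Suc k)
  let ?P = "(Poly_Mapping.single v (1::nat), Poly_Mapping.single v k)"
  have var: "mfps_coeff (mfps_var v) y = (if y = Poly_Mapping.single v 1 then 1 else 0 :: 'a)" for y
    by (simp add: mfps_var_def)
  have P: "?P \<in> monom_splits x \<longleftrightarrow> x = Poly_Mapping.single v (Suc k)"
    by (auto simp: monom_splits_def simp flip: single_add)
  have "mfps_coeff (mfps_var v ^ Suc k) x =
      (\<Sum>p\<in>monom_splits x. if p = ?P then 1 else 0 :: 'a)"
    unfolding power_Suc mfps_coeff_mult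
    by (rule sum.cong[OF refl]) (simp add: Suc case_prod_beta prod_eq_iff var)
  also have "\<dots> = (if ?P \<in> monom_splits x then 1 else 0)"
    by (rule sum.delta[OF finite_monom_splits])
  finally show ?case unfolding P .
qed

lemma mfps_coeff_power_eq_0:
  fixes F :: "('v, 'a :: comm_ring_1) mfps"
  assumes "mfps_coeff F 0 = 0"
    and "(\<Sum>v\<in>Poly_Mapping.keys x. Poly_Mapping.lookup x v) < k"
  shows "mfps_coeff (F ^ k) x = 0"
  using assms(2)
proof (induction k arbitrary: x)
  case (Suc k)
  have "mfps_coeff F y * mfps_coeff (F ^ k) z = 0" if yz: "y + z = x" for y z
  proof (cases "y = 0")
    case False
    let ?l = Poly_Mapping.lookup and ?K = "Poly_Mapping.keys x"
    have keys: "Poly_Mapping.keys y \<subseteq> ?K" "Poly_Mapping.keys z \<subseteq> ?K"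
      using yz by (auto simp: in_keys_iff lookup_add)
    have "(\<Sum>v\<in>?K. ?l x v) = (\<Sum>v\<in>?K. ?l y v) + (\<Sum>v\<in>?K. ?l z v)"
      using yz by (auto simp: lookup_add sum.distrib)
    also have "(\<Sum>v\<in>?K. ?l z v) = (\<Sum>v\<in>Poly_Mapping.keys z. ?l z v)"
      by (rule sum.mono_neutral_right) (use keys in \<open>auto simp: in_keys_iff\<close>)
    finally have *: "(\<Sum>v\<in>?K. ?l x v) = (\<Sum>v\<in>?K. ?l y v) + (\<Sum>v\<in>Poly_Mapping.keys z. ?l z v)" .
    obtain v where "v \<in> Poly_Mapping.keys y"
      using False by (metis all_not_in_conv keys_eq_empty)
    then have "0 < ?l y v" "v \<in> ?K"
      using keys(1) by (blast intro: gr0I dest: in_keys_iff[THEN iffD1])+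
    then have "0 < (\<Sum>v\<in>?K. ?l y v)"
      by (intro sum_pos2[of _ v]) simp_all
    with * Suc.prems have "mfps_coeff (F ^ k) z = 0"
      by (intro Suc.IH) linarith
    then show ?thesis by simp
  qed (simp add: assms(1))
  then show ?case
    unfolding power_Suc mfps_coeff_mult by (intro sum.neutral) (auto simp: monom_splits_def)
qed simp

lemma mfps_exp_locally_finite:
  fixes F :: "('v, 'a :: field_char_0) mfps"
  assumes "mfps_coeff F 0 = 0"
  shows "mfps_locally_finite (\<lambda>k. mfps_const (1 / fact k) * F ^ k) UNIV"
  unfolding mfps_locally_finite_def
proof
  fix x :: "'v \<Rightarrow>\<^sub>0 nat"
  have "{k \<in> UNIV. mfps_coeff (mfps_const (1 / fact k) * F ^ k) x \<noteq> 0}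
      \<subseteq> {..\<Sum>v\<in>Poly_Mapping.keys x. Poly_Mapping.lookup x v}"
  proof
    fix k assume "k \<in> {k \<in> UNIV. mfps_coeff (mfps_const (1 / fact k) * F ^ k) x \<noteq> 0}"
    then have "mfps_coeff (F ^ k) x \<noteq> 0" by simp
    then show "k \<in> {..\<Sum>v\<in>Poly_Mapping.keys x. Poly_Mapping.lookup x v}"
      using mfps_coeff_power_eq_0[OF assms, of x k] by (meson atMost_iff not_le)
  qed
  then show "finite {k \<in> UNIV. mfps_coeff (mfps_const (1 / fact k) * F ^ k) x \<noteq> 0}"
    by (rule finite_subset) simp
qed


subsection \<open>The exponent\<close>

definition G_set :: "nat \<Rightarrow> nat \<Rightarrow> nat set" where
  "G_set m l = {g. 0 < g \<and> gcd (g * l) m = g}"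

lemma finite_G_set: "0 < m \<Longrightarrow> finite (G_set m l)"
proof (rule finite_subset)
  assume "0 < m"
  then show "G_set m l \<subseteq> {..m}"
    unfolding G_set_def by (metis (mono_tags, lifting) atMost_iff gcd_le2_nat mem_Collect_eq
        less_not_refl subsetI)
qed simp

text \<open>The indeterminates are indexed by \<open>nat\<close>; \<open>t\<^sub>0\<close> exists but does not occur.\<close>

definition root_summand :: "nat \<Rightarrow> nat \<Rightarrow> (nat, rat) mfps" where
  "root_summand m l =
     (\<Sum>g\<in>G_set m l. mfps_const (of_nat l ^ (g - 1) / of_nat g) * mfps_var l ^ g)"

definition root_exponent :: "nat \<Rightarrow> (nat, rat) mfps" where
  "root_exponent m = mfps_infsum (root_summand m) {1..}"

lemma mfps_coeff_sum: "mfps_coeff (\<Sum>i\<in>A. f i) x = (\<Sum>i\<in>A. mfps_coeff (f i) x)"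
  for f :: "'i \<Rightarrow> ('v, 'a :: comm_ring_1) mfps"
  by (induction A rule: infinite_finite_induct) auto

lemma root_summand_nonzeroD:
  assumes "mfps_coeff (root_summand m l) x \<noteq> 0"
  shows "\<exists>g>0. x = Poly_Mapping.single l g"
proof (rule ccontr)
  assume "\<not> ?thesis"
  then have "mfps_coeff (root_summand m l) x = 0"
    unfolding root_summand_def mfps_coeff_sum mfps_coeff_const_mult mfps_coeff_var_power
    by (intro sum.neutral ballI) (metis (mono_tags, lifting) G_set_def mem_Collect_eq mult_zero_right)
  with assms show False by simp
qed

lemma root_summand_locally_finite: "mfps_locally_finite (root_summand m) {1..}"
  unfolding mfps_locally_finite_def
proof
  fix x :: "nat \<Rightarrow>\<^sub>0 nat"
  have "{l \<in> {1..}. mfps_coeff (root_summand m l) x \<noteq> 0} \<subseteq> Poly_Mapping.keys x"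
    by (auto dest!: root_summand_nonzeroD)
  then show "finite {l \<in> {1..}. mfps_coeff (root_summand m l) x \<noteq> 0}"
    by (rule finite_subset) simp
qed

lemma root_exponent_coeff_0: "mfps_coeff (root_exponent m) 0 = 0"
proof -
  have "mfps_coeff (root_summand m l) 0 = 0" for l
    using root_summand_nonzeroD[of m l 0] by (metis lookup_single_eq lookup_zero less_not_refl)
  then show ?thesis by (simp add: root_exponent_def mfps_infsum_def)
qed


subsection \<open>Cycle types and roots\<close>

text \<open>The cycles of a permutation of \<open>A\<close> are identified with their supports, its orbits on \<open>A\<close>.\<close>

definition has_cycle_type :: "nat \<Rightarrow> (nat \<Rightarrow> nat) \<Rightarrow> (nat \<Rightarrow> nat) \<Rightarrow> bool" where
  "has_cycle_type n \<sigma> a \<longleftrightarrow>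
     (\<forall>i\<in>{1..n}. card {C \<in> orbit \<sigma> ` {1..n}. card C = i} = a i)"

definition perm_roots :: "nat \<Rightarrow> nat \<Rightarrow> (nat \<Rightarrow> nat) \<Rightarrow> (nat \<Rightarrow> nat) set" where
  "perm_roots m n \<sigma> = {\<tau>. \<tau> permutes {1..n} \<and> \<tau> ^^ m = \<sigma>}"

end

theory Submission
  imports Defs "HOL-Number_Theory.Cong"
begin

text \<open>
  Fix a point \<open>x\<close> whose \<open>\<sigma>\<close>-cycle has length \<open>l\<close>. In an \<open>m\<close>-th root \<open>\<tau>\<close>, the cycle of \<open>x\<close> has
  length \<open>g l\<close> with \<open>gcd (g l, m) = g\<close>, and it is determined by \<open>x, \<tau> x, \<dots>, \<tau>\<^sup>g\<^sup>-\<^sup>1 x\<close>, which may be any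
  points on distinct \<open>\<sigma>\<close>-cycles of length \<open>l\<close>. Removing this cycle expresses the number of roots
  for type \<open>a\<close> through the numbers for the types with \<open>a\<^sub>l\<close> lowered by \<open>g\<close>, with coefficient
  \<open>l\<^sup>g\<^sup>-\<^sup>1 (a\<^sub>l - 1) \<cdots> (a\<^sub>l - g + 1)\<close>. Applying the Euler operator \<open>t\<^sub>l \<partial>/\<partial>t\<^sub>l\<close> to the exponential shows
  that its coefficients, multiplied by the factorials, satisfy the same recurrence.
\<close>

section \<open>Coefficients of the exponential series\<close>

abbreviation monom_degree :: "('v \<Rightarrow>\<^sub>0 nat) \<Rightarrow> nat" where
  "monom_degree x \<equiv> \<Sum>v\<in>Poly_Mapping.keys x. Poly_Mapping.lookup x v"

lemma monom_degree_le_add: "monom_degree y \<le> monom_degree (y + z)"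
proof -
  have "Poly_Mapping.keys y \<subseteq> Poly_Mapping.keys (y + z)"
    by (auto simp: in_keys_iff lookup_add)
  then have "monom_degree y \<le> (\<Sum>v\<in>Poly_Mapping.keys (y + z). Poly_Mapping.lookup y v)"
    by (intro sum_mono2) auto
  also have "\<dots> \<le> monom_degree (y + z)"
    by (intro sum_mono) (simp add: lookup_add)
  finally show ?thesis .
qed

text \<open>As \<open>F\<close> has no constant term, \<open>F ^ k\<close> has no monomial of degree
  below \<open>k\<close>, so the series stops before any bound \<open>K\<close> above the degree of
  \<open>x\<close>. Leaving \<open>K\<close> free lets one bound serve all divisors of a monomial at
  once.\<close>

lemma mfps_coeff_exp:
  fixes F :: "('v, 'a :: field_char_0) mfps"
  assumes "mfps_coeff F 0 = 0" "monom_degree x < K"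
  shows "mfps_coeff (mfps_exp F) x = (\<Sum>k<K. mfps_coeff (F ^ k) x / fact k)"
proof -
  have "mfps_coeff (F ^ k) x = 0" if "\<not> k < K" for k
    using mfps_coeff_power_eq_0[OF assms(1), of x k] assms(2) that by simp
  then show ?thesis
    unfolding mfps_exp_def mfps_infsum_def mfps_coeff_Abs
    by (intro sum.mono_neutral_cong_left) auto
qed

section \<open>The Euler operator and the exponential\<close>

definition mfps_euler :: "'v \<Rightarrow> ('v, 'a :: semiring_1) mfps \<Rightarrow> ('v, 'a) mfps" where
  "mfps_euler v F = Abs_mfps (\<lambda>x. of_nat (Poly_Mapping.lookup x v) * mfps_coeff F x)"

lemma mfps_coeff_euler [simp]:
  "mfps_coeff (mfps_euler v F) x = of_nat (Poly_Mapping.lookup x v) * mfps_coeff F x"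
  by (simp add: mfps_euler_def)

lemma mfps_euler_mult:
  "mfps_euler v (F * G) = mfps_euler v F * G + F * mfps_euler v G"
  for F G :: "('v, 'a :: comm_ring_1) mfps"
proof (rule mfps_eqI)
  fix x
  have "mfps_coeff (mfps_euler v (F * G)) x
      = (\<Sum>p\<in>monom_splits x. (of_nat (Poly_Mapping.lookup (fst p) v) * mfps_coeff F (fst p)) *
          mfps_coeff G (snd p) + mfps_coeff F (fst p) *
          (of_nat (Poly_Mapping.lookup (snd p) v) * mfps_coeff G (snd p)))"
    unfolding mfps_coeff_euler mfps_coeff_mult sum_distrib_left
    by (intro sum.cong refl) (auto simp: monom_splits_def lookup_add algebra_simps)
  then show "mfps_coeff (mfps_euler v (F * G)) x
      = mfps_coeff (mfps_euler v F * G + F * mfps_euler v G) x"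
    by (simp add: mfps_coeff_mult sum.distrib case_prod_beta)
qed

lemma mfps_coeff_of_nat_mult: "mfps_coeff (of_nat n * F) x = of_nat n * mfps_coeff F x"
  for F :: "('v, 'a :: comm_ring_1) mfps"
  by (induction n) (auto simp: algebra_simps)

lemma mfps_euler_power_Suc:
  "mfps_euler v (F ^ Suc k) = of_nat (Suc k) * (F ^ k * mfps_euler v F)"
  for F :: "('v, 'a :: comm_ring_1) mfps"
proof (induction k)
  case (Suc k)
  have "mfps_euler v (F ^ Suc (Suc k)) = mfps_euler v F * F ^ Suc k + F * mfps_euler v (F ^ Suc k)"
    by (simp only: power_Suc[of F "Suc k"] mfps_euler_mult)
  then show ?case
    unfolding Suc by (simp add: algebra_simps)
qed simp

text \<open>Term by term, the power rule gives the factor \<open>of_nat (Suc k)\<close>, which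
  cancels against \<open>fact (Suc k)\<close> and shifts the index by one. A bound above the degree
  of \<open>x\<close> also exceeds the degree of every divisor, so all sums over \<open>k\<close>
  are finite.\<close>

lemma mfps_euler_exp:
  fixes F :: "('v, 'a :: field_char_0) mfps"
  assumes "mfps_coeff F 0 = 0"
  shows "mfps_euler v (mfps_exp F) = mfps_exp F * mfps_euler v F"
proof (rule mfps_eqI)
  fix x :: "'v \<Rightarrow>\<^sub>0 nat"
  obtain K where x_less: "monom_degree x < K"
    by blast
  have K: "monom_degree y < K" if "(y, z) \<in> monom_splits x" for y z
    using that monom_degree_le_add[of y z] x_less by (auto simp: monom_splits_def)
  \<comment> \<open>The bound is \<open>Suc K\<close> because the term \<open>k = 0\<close> is
    killed by the operator; after the index shift the sum runs over \<open>k < K\<close>.\<close>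
  have "mfps_coeff (mfps_euler v (mfps_exp F)) x
      = (\<Sum>k<Suc K. mfps_coeff (mfps_euler v (F ^ k)) x / fact k)"
    unfolding mfps_coeff_euler mfps_coeff_exp[OF assms less_SucI[OF x_less]]
    by (simp only: sum_distrib_left times_divide_eq_right)
  also have "\<dots> = (\<Sum>k<K. mfps_coeff (mfps_euler v (F ^ Suc k)) x / fact (Suc k))"
    by (subst sum.lessThan_Suc_shift) (auto simp: mfps_coeff_one)
  also have "\<dots> = (\<Sum>k<K. mfps_coeff (F ^ k * mfps_euler v F) x / fact k)"
    unfolding mfps_euler_power_Suc mfps_coeff_of_nat_mult fact_Suc
    by (intro sum.cong refl) (simp del: of_nat_Suc)
  also have "\<dots> = (\<Sum>(y, z)\<in>monom_splits x.
      (\<Sum>k<K. mfps_coeff (F ^ k) y / fact k) * mfps_coeff (mfps_euler v F) z)"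
    unfolding mfps_coeff_mult sum_divide_distrib
    by (subst sum.swap) (simp add: sum_distrib_left sum_distrib_right case_prod_beta mult_ac)
  also have "\<dots> = mfps_coeff (mfps_exp F * mfps_euler v F) x"
    unfolding mfps_coeff_mult
    by (intro sum.cong refl) (auto simp: mfps_coeff_exp[OF assms K])
  finally show "mfps_coeff (mfps_euler v (mfps_exp F)) x
      = mfps_coeff (mfps_exp F * mfps_euler v F) x" .
qed

text \<open>Only \<open>root_summand m l\<close> involves the indeterminate with index
  \<open>l\<close>, and the operator multiplies its \<open>g\<close>-th power by \<open>g\<close>,
  which cancels the denominator in the exponent.\<close>

lemma mfps_coeff_euler_root_exponent:
  assumes "0 < l"
  shows "mfps_coeff (mfps_euler l (root_exponent m)) z
    = (\<Sum>g\<in>G_set m l. if z = Poly_Mapping.single l g then of_nat l ^ (g - 1) else 0)"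
proof (cases "Poly_Mapping.lookup z l = 0")
  case True
  then have "z \<noteq> Poly_Mapping.single l g" if "g \<in> G_set m l" for g
    using that by (auto simp: G_set_def)
  with True show ?thesis by simp
next
  case False
  have summand_eq: "i = l" if "mfps_coeff (root_summand m i) z \<noteq> 0" for i
    using root_summand_nonzeroD[OF that] False by (auto simp: lookup_single when_def split: if_splits)
  have *: "{i \<in> {1..}. mfps_coeff (root_summand m i) z \<noteq> 0} =
      (if mfps_coeff (root_summand m l) z = 0 then {} else {l})"
    using assms by (auto dest: summand_eq simp: Suc_le_eq)
  have "mfps_coeff (root_exponent m) z = mfps_coeff (root_summand m l) z"
    unfolding root_exponent_def mfps_infsum_def mfps_coeff_Abs * by simp
  then show ?thesis
    by (auto simp: root_summand_def mfps_coeff_sum mfps_coeff_var_power sum_distrib_left G_set_def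
        intro!: sum.cong)
qed

text \<open>Comparison of coefficients in \<open>mfps_euler_exp\<close>. The term for
  \<open>g\<close> contributes only if the \<open>g\<close>-th power of the indeterminate divides
  \<open>x\<close>; hence the bound on \<open>g\<close>, which makes the truncated difference a
  genuine quotient of monomials.\<close>

lemma coeff_exp_root_exponent_rec:
  fixes x :: "nat \<Rightarrow>\<^sub>0 nat"
  assumes "0 < m" "0 < l"
  defines "E \<equiv> mfps_coeff (mfps_exp (root_exponent m))"
  shows "of_nat (Poly_Mapping.lookup x l) * E x
    = (\<Sum>g\<in>{g \<in> G_set m l. g \<le> Poly_Mapping.lookup x l}.
        of_nat l ^ (g - 1) * E (x - Poly_Mapping.single l g))"
proof -
  let ?s = "Poly_Mapping.single l"
  have split_iff: "p \<in> monom_splits x \<and> snd p = ?s g \<longleftrightarrow>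
      g \<le> Poly_Mapping.lookup x l \<and> p = (x - ?s g, ?s g)" for p g
  proof -
    have "x - ?s g + ?s g = x" if "g \<le> Poly_Mapping.lookup x l"
      by (rule poly_mapping_eqI)
        (use that in \<open>auto simp: lookup_add lookup_minus lookup_single when_def\<close>)
    then show ?thesis
      by (cases p) (auto simp: monom_splits_def lookup_add)
  qed
  have "of_nat (Poly_Mapping.lookup x l) * E x
      = mfps_coeff (mfps_euler l (mfps_exp (root_exponent m))) x"
    by (simp add: E_def)
  also have "\<dots> = (\<Sum>p\<in>monom_splits x. E (fst p) *
      (\<Sum>g\<in>G_set m l. if snd p = ?s g then of_nat l ^ (g - 1) else 0))"
    by (subst mfps_euler_exp[OF root_exponent_coeff_0])
      (simp add: mfps_coeff_mult mfps_coeff_euler_root_exponent[OF assms(2)] E_def case_prod_beta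
        del: mfps_coeff_euler)
  also have "\<dots> = (\<Sum>g\<in>G_set m l. \<Sum>p\<in>monom_splits x.
      if snd p = ?s g then E (fst p) * of_nat l ^ (g - 1) else 0)"
    unfolding sum_distrib_left by (subst sum.swap) (auto intro!: sum.cong)
  also have "\<dots> = (\<Sum>g\<in>G_set m l. if g \<le> Poly_Mapping.lookup x l
      then of_nat l ^ (g - 1) * E (x - ?s g) else 0)"
  proof (intro sum.cong refl)
    fix g
    have "(\<Sum>p\<in>monom_splits x. if snd p = ?s g then E (fst p) * of_nat l ^ (g - 1) else 0)
        = (\<Sum>p | p \<in> monom_splits x \<and> snd p = ?s g. E (fst p) * of_nat l ^ (g - 1))"
      by (simp add: sum.If_cases Int_def)
    also have "\<dots> = (\<Sum>p\<in>(if g \<le> Poly_Mapping.lookup x l then {(x - ?s g, ?s g)} else {}).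
        E (fst p) * of_nat l ^ (g - 1))"
      unfolding split_iff by (rule sum.cong) auto
    finally show "(\<Sum>p\<in>monom_splits x. if snd p = ?s g then E (fst p) * of_nat l ^ (g - 1) else 0)
        = (if g \<le> Poly_Mapping.lookup x l then of_nat l ^ (g - 1) * E (x - ?s g) else 0)"
      by (simp add: mult.commute)
  qed
  also have "\<dots> = (\<Sum>g\<in>{g \<in> G_set m l. g \<le> Poly_Mapping.lookup x l}.
        of_nat l ^ (g - 1) * E (x - ?s g))"
    by (rule sum.inter_filter[symmetric]) (rule finite_G_set[OF assms(1)])
  finally show ?thesis .
qed

section \<open>Orbits and local roots\<close>

text \<open>The first return time of \<open>x\<close> is the size of its orbit, and the iterates
  before it are pairwise distinct. This turns questions about cycles into congruences.\<close>

lemma funpow_eq_iff_cong: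
  assumes "permutation f"
  shows "(f ^^ i) x = (f ^^ j) x \<longleftrightarrow> [i = j] (mod card (orbit f x))"
proof -
  define N where "N = funpow_dist1 f x x"
  have x: "x \<in> orbit f x"
    using assms by (rule permutation_self_in_orbit)
  have inj: "inj_on (\<lambda>n. (f ^^ n) x) {0..<N}"
    unfolding N_def by (rule inj_on_funpow_dist1[OF x])
  have card: "card (orbit f x) = N"
    using orbit_conv_funpow_dist1[OF x] card_image[OF inj] by (simp add: N_def)
  have "(f ^^ N) x = x"
    unfolding N_def by (rule funpow_dist1_prop[OF x])
  then have reduce: "(f ^^ n) x = (f ^^ (n mod N)) x" for n
    by (simp add: funpow_mod_eq)
  have "(f ^^ i) x = (f ^^ j) x \<longleftrightarrow> i mod N = j mod N"
    unfolding reduce[of i] reduce[of j] using inj_on_eq_iff[OF inj, of "i mod N" "j mod N"]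
    by (simp add: N_def)
  then show ?thesis
    by (simp add: card cong_def)
qed

lemma orbit_eq_if_mem:
  assumes "permutation f" "y \<in> orbit f x"
  shows "orbit f y = orbit f x"
  using orbit_cyclic_eq3[OF cyclic_on_orbit'[OF assms(1)] assms(2)] .

lemma orbit_funpow [simp]:
  assumes "permutation f"
  shows "orbit f ((f ^^ n) x) = orbit f x"
  using assms by (intro orbit_eq_if_mem funpow_in_orbit permutation_self_in_orbit)

lemma card_orbit_pos:
  assumes "permutation f"
  shows "0 < card (orbit f x)"
  using assms by (simp add: card_gt_0_iff finite_orbit permutation_self_in_orbit orbit_nonempty)

text \<open>\<open>\<sigma>\<close> itself is not restricted: only its values on \<open>A\<close>
  matter, while a root is the identity outside \<open>A\<close>. Cycles can thus be deleted from
  \<open>A\<close> with \<open>\<sigma>\<close> kept fixed.\<close>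

definition local_roots :: "nat \<Rightarrow> ('a \<Rightarrow> 'a) \<Rightarrow> 'a set \<Rightarrow> ('a \<Rightarrow> 'a) set" where
  "local_roots m \<sigma> A = {\<tau>. \<tau> permutes A \<and> (\<forall>z\<in>A. (\<tau> ^^ m) z = \<sigma> z)}"

lemma finite_local_roots: "finite A \<Longrightarrow> finite (local_roots m \<sigma> A)"
  by (rule finite_subset[OF _ finite_permutations]) (auto simp: local_roots_def)

lemma funpow_mem_permutes: "\<tau> permutes A \<Longrightarrow> z \<in> A \<Longrightarrow> (\<tau> ^^ n) z \<in> A"
  by (induction n) (auto simp: permutes_in_image)

lemma funpow_comp_disjoint:
  assumes "c permutes B" "\<rho> permutes D" "D \<inter> B = {}" "z \<in> D"
  shows "((c \<circ> \<rho>) ^^ j) z = (\<rho> ^^ j) z"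
proof (induction j)
  case (Suc j)
  have "(\<rho> ^^ Suc j) z \<notin> B"
    using funpow_mem_permutes[OF assms(2,4), of "Suc j"] assms(3) by blast
  then have "c (\<rho> ((\<rho> ^^ j) z)) = (\<rho> ^^ Suc j) z"
    using permutes_not_in[OF assms(1)] by simp
  with Suc show ?case
    by (simp only: funpow.simps comp_apply)
qed simp

lemma local_root_funpow:
  assumes "\<tau> \<in> local_roots m \<sigma> A" "z \<in> A"
  shows "(\<tau> ^^ (m * j)) z = (\<sigma> ^^ j) z"
proof (induction j)
  case (Suc j)
  have "(\<tau> ^^ (m * Suc j)) z = (\<tau> ^^ m) ((\<tau> ^^ (m * j)) z)"
    by (simp add: funpow_add)
  also have "\<dots> = \<sigma> ((\<tau> ^^ (m * j)) z)"
    using assms by (auto simp: local_roots_def funpow_mem_permutes)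
  finally show ?case
    by (simp add: Suc)
qed simp

text \<open>The \<open>m\<close>-th power of a cycle of length \<open>N\<close> splits into
  \<open>gcd N m\<close> cycles of equal length. With \<open>g = gcd N m\<close> this gives
  \<open>N = g * l\<close>, which is the origin of the condition defining
  \<open>G_set\<close>.\<close>

lemma local_root_orbit_card:
  assumes "permutation \<sigma>" "finite A" "\<tau> \<in> local_roots m \<sigma> A" "z \<in> A"
  shows "gcd (card (orbit \<tau> z)) m * card (orbit \<sigma> z) = card (orbit \<tau> z)"
proof -
  define N where "N = card (orbit \<tau> z)"
  have \<tau>: "permutation \<tau>"
    using assms by (auto simp: local_roots_def permutation_permutes)
  have "gcd N m \<noteq> 0"
    using card_orbit_pos[OF \<tau>] by (simp add: N_def)
  then obtain u w where uw: "N = u * gcd N m" "m = w * gcd N m" "coprime u w"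
    using gcd_coprime_exists by blast
  \<comment> \<open>A cycle length is determined by its multiples, the exponents \<open>j\<close>
    for which \<open>\<sigma> ^^ j\<close> fixes \<open>z\<close>; these are computed inside the
    \<tau>-cycle.\<close>
  have "card (orbit \<sigma> z) dvd j \<longleftrightarrow> u dvd j" for j
  proof -
    have "card (orbit \<sigma> z) dvd j \<longleftrightarrow> (\<sigma> ^^ j) z = (\<sigma> ^^ 0) z"
      by (simp only: funpow_eq_iff_cong[OF assms(1)] cong_0_iff)
    also have "\<dots> \<longleftrightarrow> (\<tau> ^^ (m * j)) z = (\<tau> ^^ 0) z"
      by (simp add: local_root_funpow[OF assms(3,4)])
    also have "\<dots> \<longleftrightarrow> N dvd m * j"
      by (simp only: funpow_eq_iff_cong[OF \<tau>] cong_0_iff N_def)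
    also have "\<dots> \<longleftrightarrow> gcd N m * u dvd gcd N m * (w * j)"
      by (subst uw(1), subst (2) uw(2)) (simp only: mult_ac)
    also have "\<dots> \<longleftrightarrow> u dvd w * j"
      using \<open>gcd N m \<noteq> 0\<close> by (rule dvd_times_left_cancel_iff)
    also have "\<dots> \<longleftrightarrow> u dvd j"
      using uw(3) by (rule coprime_dvd_mult_right_iff)
    finally show ?thesis .
  qed
  then have "card (orbit \<sigma> z) = u"
    by (meson dvd_antisym dvd_refl)
  with uw(1) show ?thesis
    by (simp add: N_def mult.commute)
qed

section \<open>Extending a root by one cycle\<close>

text \<open>Splits a position on a cycle of length \<open>g * l\<close> into the index
  \<open>s mod g\<close> of the \<sigma>-cycle visited and the number \<open>s div g\<close> of
  rounds made, which counts modulo \<open>l\<close>.\<close>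

lemma cong_mult_iff_div_mod:
  fixes s t g l :: nat
  assumes "0 < g"
  shows "[s = t] (mod g * l) \<longleftrightarrow> s mod g = t mod g \<and> [s div g = t div g] (mod l)"
proof
  assume "[s = t] (mod g * l)"
  then have *: "g * (s div g mod l) + s mod g = g * (t div g mod l) + t mod g"
    by (simp add: cong_def mod_mult2_eq)
  from arg_cong[OF *, of "\<lambda>n. n mod g"] arg_cong[OF *, of "\<lambda>n. n div g"] assms
  show "s mod g = t mod g \<and> [s div g = t div g] (mod l)"
    by (simp add: cong_def)
qed (simp add: cong_def mod_mult2_eq)

text \<open>Solving \<open>m k \<equiv> g\<close> modulo \<open>g l\<close>: the \<open>g\<close>-th power of a cycle of length \<open>g l\<close> is the
  \<open>k\<close>-th power of its \<open>m\<close>-th power.\<close>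

lemma G_set_inverse:
  assumes "g \<in> G_set m l"
  obtains w k where "m = g * w" "[k * w = 1] (mod l)" "coprime k l"
proof -
  have g: "0 < g" "gcd (g * l) m = g"
    using assms by (auto simp: G_set_def)
  then obtain w where w: "m = g * w"
    by (metis dvdE gcd_dvd2)
  \<comment> \<open>Cancelling \<open>g\<close> in \<open>gcd (g * l) (g * w) = g\<close> leaves
    \<open>gcd l w = 1\<close>.\<close>
  with g have "coprime w l"
    by (simp add: gcd_mult_left coprime_iff_gcd_eq_1 gcd.commute)
  then obtain k where k: "[w * k = 1] (mod l)"
    using cong_solve_coprime_nat by auto
  then have "[k * w = 1] (mod l)"
    by (simp add: mult.commute)
  moreover from this have "coprime k l"
    by (metis coprime_iff_invertible_nat One_nat_def)
  ultimately show ?thesis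
    using that w by blast
qed

text \<open>\<open>\<phi>\<close> is the future cycle, written out before the root exists:
  \<open>\<phi> s\<close> is to be the image of \<open>ys ! 0\<close> after \<open>s\<close> steps.
  Distinctness of the \<sigma>-cycles of \<open>ys\<close> makes its period exactly
  \<open>g * l\<close>.\<close>

lemma block_enumeration:
  assumes \<sigma>: "permutation \<sigma>" and G: "g \<in> G_set m l"
    and ys: "length ys = g" "distinct (map (orbit \<sigma>) ys)" "\<And>y. y \<in> set ys \<Longrightarrow> card (orbit \<sigma> y) = l"
  obtains \<phi> where
    "\<And>s t. \<phi> s = \<phi> t \<longleftrightarrow> [s = t] (mod g * l)"
    "\<And>s j. \<phi> (s + m * j) = (\<sigma> ^^ j) (\<phi> s)"
    "range \<phi> = \<Union> (orbit \<sigma> ` set ys)"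
    "\<And>i. i < g \<Longrightarrow> \<phi> i = ys ! i"
proof -
  have g: "0 < g"
    using G by (simp add: G_set_def)
  obtain w k where m: "m = g * w" and k: "[k * w = 1] (mod l)" "coprime k l"
    using G_set_inverse[OF G] .
  \<comment> \<open>After \<open>g\<close> steps the cycle is back on the same \<sigma>-cycle,
    advanced by \<open>\<sigma> ^^ k\<close>, where \<open>k\<close> inverts \<open>m div g\<close>
    modulo \<open>l\<close>; thus \<open>m\<close> steps amount to one application of
    \<open>\<sigma>\<close>.\<close>
  define \<phi> where "\<phi> s = (\<sigma> ^^ (k * (s div g))) (ys ! (s mod g))" for s
  have nth: "ys ! (s mod g) \<in> set ys" for s
    using g ys(1) by simp
  have orb: "orbit \<sigma> (\<phi> s) = orbit \<sigma> (ys ! (s mod g))" for s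
    by (simp add: \<phi>_def \<sigma>)
  have "\<phi> s = \<phi> t \<longleftrightarrow> s mod g = t mod g \<and> [s div g = t div g] (mod l)" for s t
  proof (cases "s mod g = t mod g")
    case True
    then have "\<phi> s = \<phi> t \<longleftrightarrow> [k * (s div g) = k * (t div g)] (mod l)"
      unfolding \<phi>_def by (simp add: funpow_eq_iff_cong[OF \<sigma>] ys(3)[OF nth])
    with True show ?thesis
      using cong_mult_lcancel_nat[OF k(2)] by simp
  next
    case False
    then have "orbit \<sigma> (ys ! (s mod g)) \<noteq> orbit \<sigma> (ys ! (t mod g))"
      using g ys(1) nth_eq_iff_index_eq[OF ys(2), of "s mod g" "t mod g"] by simp
    then show ?thesis
      using orb[of s] orb[of t] False by auto
  qed
  then have eq_iff: "\<phi> s = \<phi> t \<longleftrightarrow> [s = t] (mod g * l)" for s t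
    by (simp add: cong_mult_iff_div_mod[OF g])
  have step: "\<phi> (s + m * j) = (\<sigma> ^^ j) (\<phi> s)" for s j
  proof -
    let ?y = "ys ! (s mod g)"
    have "(s + m * j) div g = s div g + w * j" "(s + m * j) mod g = s mod g"
      using g by (simp_all add: m mult.assoc)
    then have "\<phi> (s + m * j) = (\<sigma> ^^ (k * (s div g) + k * w * j)) ?y"
      by (simp add: \<phi>_def algebra_simps)
    also have "\<dots> = (\<sigma> ^^ (k * (s div g) + 1 * j)) ?y"
      unfolding funpow_eq_iff_cong[OF \<sigma>] ys(3)[OF nth]
      by (intro cong_add cong_mult cong_refl k(1))
    also have "\<dots> = (\<sigma> ^^ j) (\<phi> s)"
      unfolding \<phi>_def by (subst add.commute) (simp add: funpow_add)
    finally show ?thesis .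
  qed
  have init: "\<phi> i = ys ! i" if "i < g" for i
    using that by (simp add: \<phi>_def)
  have "range \<phi> = \<Union> (orbit \<sigma> ` set ys)"
  proof (intro subset_antisym subsetI)
    fix z assume "z \<in> range \<phi>"
    then show "z \<in> \<Union> (orbit \<sigma> ` set ys)"
      using orb permutation_self_in_orbit[OF \<sigma>] nth by blast
  next
    fix z assume "z \<in> \<Union> (orbit \<sigma> ` set ys)"
    then obtain i where "i < g" "z \<in> orbit \<sigma> (\<phi> i)"
      by (auto simp: in_set_conv_nth ys(1) init)
    then obtain j where "z = \<phi> (i + m * j)"
      unfolding orbit_altdef_permutation[OF \<sigma>] step by blast
    then show "z \<in> range \<phi>"
      by blast
  qed
  with eq_iff step init show ?thesis
    using that by blast
qed

text \<open>\<open>\<phi>\<close> identifies the residues modulo \<open>N\<close> with its range,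
  and the successor map is transported along it. The representative chosen by
  \<open>inv \<phi>\<close> is immaterial, since congruent numbers have congruent
  successors.\<close>

lemma shift_permutation:
  fixes \<phi> :: "nat \<Rightarrow> 'a"
  assumes "0 < N" and eq_iff: "\<And>s t. \<phi> s = \<phi> t \<longleftrightarrow> [s = t] (mod N)"
  obtains c where "c permutes range \<phi>" "\<And>s. c (\<phi> s) = \<phi> (Suc s)"
proof -
  define c where "c z = (if z \<in> range \<phi> then \<phi> (Suc (inv \<phi> z)) else z)" for z
  have inv_cong: "[inv \<phi> (\<phi> s) = s] (mod N)" for s
    by (simp add: f_inv_into_f flip: eq_iff)
  have Suc_cong: "[Suc s = Suc t] (mod N) \<longleftrightarrow> [s = t] (mod N)" for s t
    using cong_add_rcancel_nat[of s 1 t N] by simp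
  have c: "c (\<phi> s) = \<phi> (Suc s)" for s
    unfolding c_def by (simp only: rangeI if_True eq_iff Suc_cong inv_cong)
  have "bij_betw c (range \<phi>) (range \<phi>)"
  proof (rule bij_betw_imageI)
    show "inj_on c (range \<phi>)"
      by (auto intro!: inj_onI simp: c eq_iff Suc_cong)
    have "\<phi> s \<in> c ` range \<phi>" for s
    proof -
      have "\<phi> s = \<phi> (Suc (s + N - 1))"
        using \<open>0 < N\<close> by (simp add: eq_iff cong_def)
      then show ?thesis
        by (metis c imageI rangeI)
    qed
    then show "c ` range \<phi> = range \<phi>"
      by (auto simp: c)
  qed
  then have "c permutes range \<phi>"
    by (rule bij_imp_permutes) (simp add: c_def)
  with c show ?thesis
    using that by blast
qed

text \<open>The first \<open>g\<close> points force the whole cycle, which is the cycle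
  \<open>c\<close> on \<open>B\<close>. Composing with \<open>c\<close> therefore turns a root on
  \<open>A - B\<close> into a root on \<open>A\<close> with this cycle, and composing with
  \<open>inv c\<close> undoes it.\<close>

lemma card_local_roots_fibre:
  assumes \<sigma>: "permutation \<sigma>" and A: "finite A" and G: "g \<in> G_set m l"
    and ys: "length ys = g" "distinct (map (orbit \<sigma>) ys)" "\<And>y. y \<in> set ys \<Longrightarrow> card (orbit \<sigma> y) = l"
    and x: "x \<in> A" "hd ys = x"
    and B: "B = \<Union> (orbit \<sigma> ` set ys)" "B \<subseteq> A"
  shows "card {\<tau> \<in> local_roots m \<sigma> A. card (orbit \<tau> x) = g * l \<and> map (\<lambda>i. (\<tau> ^^ i) x) [0..<g] = ys}
    = card (local_roots m \<sigma> (A - B))"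
    (is "card ?T = _")
proof -
  have g: "0 < g"
    using G by (simp add: G_set_def)
  then have ys_ne: "ys \<noteq> []"
    using ys(1) by auto
  then have x_ys: "x = ys ! 0" "x \<in> set ys"
    using x(2) by (auto simp: hd_conv_nth)
  then have l: "0 < l"
    using ys(3) card_orbit_pos[OF \<sigma>] by force
  obtain \<phi> where eq_iff: "\<And>s t. \<phi> s = \<phi> t \<longleftrightarrow> [s = t] (mod g * l)"
    and step: "\<And>s j. \<phi> (s + m * j) = (\<sigma> ^^ j) (\<phi> s)"
    and range: "range \<phi> = B"
    and init: "\<And>i. i < g \<Longrightarrow> \<phi> i = ys ! i"
    using block_enumeration[OF \<sigma> G ys] unfolding B(1) by blast
  have \<phi>_B [simp]: "\<phi> s \<in> B" for s
    using range by blast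
  have \<phi>0: "\<phi> 0 = x"
    using init[OF g] x_ys by simp
  obtain c where c_perm: "c permutes B" and c: "\<And>s. c (\<phi> s) = \<phi> (Suc s)"
    using shift_permutation[of "g * l" \<phi>] eq_iff g l unfolding range by auto
  have on_block: "(\<tau> ^^ s) x = \<phi> s" if "\<tau> \<in> ?T" for \<tau> s
  proof -
    have \<tau>: "\<tau> \<in> local_roots m \<sigma> A" "card (orbit \<tau> x) = g * l" "permutation \<tau>" "\<tau> permutes A"
      using that A by (auto simp: local_roots_def permutation_permutes)
    have \<tau>_init: "(\<tau> ^^ i) x = ys ! i" if "i < g" for i
      using \<open>\<tau> \<in> ?T\<close> that by (auto dest!: arg_cong[of _ _ "\<lambda>xs. xs ! i"])
    obtain w k where m: "m = g * w" and k: "[k * w = 1] (mod l)"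
      using G_set_inverse[OF G] .
    \<comment> \<open>Modulo \<open>g * l\<close>, the exponent \<open>s\<close> is rewritten as
      \<open>i + m * j\<close> with \<open>i < g\<close>: the first \<open>i\<close> steps are
      prescribed by \<open>ys\<close>, and the remaining \<open>m * j\<close> act as
      \<open>\<sigma> ^^ j\<close>.\<close>
    define i j where "i = s mod g" and "j = k * (s div g)"
    have ij: "[i + m * j = s] (mod g * l)"
    proof -
      have "[k * w * (s div g) = 1 * (s div g)] (mod l)"
        by (intro cong_mult k cong_refl)
      then have "[w * j = s div g] (mod l)"
        by (simp add: j_def mult_ac)
      moreover have "(i + m * j) div g = w * j"
        using g by (simp add: i_def m mult.assoc)
      moreover have "(i + m * j) mod g = s mod g"
        using g by (simp add: i_def m mult.assoc)
      ultimately show ?thesis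
        by (simp add: cong_mult_iff_div_mod[OF g])
    qed
    have "(\<tau> ^^ s) x = (\<tau> ^^ (m * j + i)) x"
      unfolding funpow_eq_iff_cong[OF \<tau>(3)] \<tau>(2) using ij by (simp add: cong_sym add.commute)
    also have "\<dots> = (\<sigma> ^^ j) ((\<tau> ^^ i) x)"
      using local_root_funpow[OF \<tau>(1), of "(\<tau> ^^ i) x" j] funpow_mem_permutes[OF \<tau>(4) x(1)]
      by (simp add: funpow_add)
    also have "\<dots> = \<phi> (i + m * j)"
      using g by (simp add: \<tau>_init step init i_def)
    also have "\<dots> = \<phi> s"
      using ij by (simp add: eq_iff)
    finally show ?thesis .
  qed
  have "bij_betw ((\<circ>) c) (local_roots m \<sigma> (A - B)) ?T"
  proof (rule bij_betw_imageI)
    show "inj_on ((\<circ>) c) (local_roots m \<sigma> (A - B))"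
      using permutes_inj[OF c_perm] by (auto intro!: inj_onI simp: fun_eq_iff inj_eq)
    show "(\<circ>) c ` local_roots m \<sigma> (A - B) = ?T"
    proof (intro subset_antisym subsetI)
      fix \<tau> assume "\<tau> \<in> (\<circ>) c ` local_roots m \<sigma> (A - B)"
      then obtain \<rho> where \<tau>: "\<tau> = c \<circ> \<rho>" and \<rho>: "\<rho> permutes A - B"
        and \<rho>_root: "\<And>z. z \<in> A - B \<Longrightarrow> (\<rho> ^^ m) z = \<sigma> z"
        by (auto simp: local_roots_def)
      have \<tau>_perm: "\<tau> permutes A"
        unfolding \<tau> using B(2)
        by (intro permutes_compose permutes_subset[OF \<rho>] permutes_subset[OF c_perm]) auto
      have "\<tau> (\<phi> s) = \<phi> (Suc s)" for s
        using permutes_not_in[OF \<rho>, of "\<phi> s"] by (simp add: \<tau> c)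
      then have \<tau>_\<phi>: "(\<tau> ^^ j) (\<phi> s) = \<phi> (s + j)" for j s
        by (induction j) auto
      have \<tau>_\<rho>: "(\<tau> ^^ j) z = (\<rho> ^^ j) z" if "z \<in> A - B" for z j
        unfolding \<tau> by (rule funpow_comp_disjoint[OF c_perm \<rho> _ that]) blast
      have "(\<tau> ^^ m) z = \<sigma> z" if "z \<in> A" for z
      proof (cases "z \<in> B")
        case True
        then obtain s where "z = \<phi> s"
          using range by blast
        then show ?thesis
          using step[of s 1] by (simp add: \<tau>_\<phi>)
      qed (use that \<tau>_\<rho> \<rho>_root in auto)
      then have root: "\<tau> \<in> local_roots m \<sigma> A"
        using \<tau>_perm by (simp add: local_roots_def)
      have \<tau>_x: "(\<tau> ^^ s) x = \<phi> s" for s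
        using \<tau>_\<phi>[of s 0] by (simp add: \<phi>0)
      have perm: "permutation \<tau>"
        using \<tau>_perm A by (auto simp: permutation_permutes)
      \<comment> \<open>The returns of \<open>\<tau>\<close> to \<open>x\<close> are those of
        \<open>\<phi>\<close> to its initial value, so both periods have the same multiples.\<close>
      have "card (orbit \<tau> x) dvd j \<longleftrightarrow> g * l dvd j" for j
        using funpow_eq_iff_cong[OF perm, of j x 0] eq_iff[of j 0]
        unfolding \<tau>_x by (simp add: cong_0_iff)
      then have "card (orbit \<tau> x) = g * l"
        by (meson dvd_antisym dvd_refl)
      moreover have "map (\<lambda>i. (\<tau> ^^ i) x) [0..<g] = ys"
        by (rule nth_equalityI) (simp_all add: ys(1) \<tau>_x init)
      ultimately show "\<tau> \<in> ?T"
        using root by simp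
    next
      fix \<tau> assume T: "\<tau> \<in> ?T"
      then have \<tau>: "\<tau> permutes A" "\<And>z. z \<in> A \<Longrightarrow> (\<tau> ^^ m) z = \<sigma> z"
        by (auto simp: local_roots_def)
      define \<rho> where "\<rho> = inv c \<circ> \<tau>"
      have \<tau>_eq: "\<tau> = c \<circ> \<rho>"
        using permutes_inv_o(1)[OF c_perm] by (simp add: \<rho>_def o_assoc)
      have "\<rho> permutes A"
        unfolding \<rho>_def using B(2) c_perm \<tau>(1)
        by (intro permutes_compose permutes_subset[OF permutes_inv]) auto
      moreover have "\<rho> z = z" if "z \<in> A - (A - B)" for z
      proof -
        have "z \<in> range \<phi>"
          using that range by simp
        then obtain s where s: "z = \<phi> s"
          by blast
        have "\<tau> z = c z"
          using on_block[OF T, of s] on_block[OF T, of "Suc s"] by (simp add: s c)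
        then show ?thesis
          using permutes_inverses(2)[OF c_perm] by (simp add: \<rho>_def)
      qed
      ultimately have \<rho>: "\<rho> permutes A - B"
        by (rule permutes_superset) blast
      have "(\<rho> ^^ j) z = (\<tau> ^^ j) z" if "z \<in> A - B" for z j
        unfolding \<tau>_eq by (rule funpow_comp_disjoint[OF c_perm \<rho> _ that, symmetric]) blast
      then have "\<rho> \<in> local_roots m \<sigma> (A - B)"
        using \<rho> \<tau>(2) by (auto simp: local_roots_def)
      then show "\<tau> \<in> (\<circ>) c ` local_roots m \<sigma> (A - B)"
        using \<tau>_eq by blast
    qed
  qed
  then show ?thesis
    by (simp add: bij_betw_same_card)
qed

section \<open>The recurrence for the number of roots\<close>

text \<open>Entries are chosen one at a time: a further entry must avoid the fibres over the
  \<open>h\<close> values already used. Once all values are used up, a factor vanishes.\<close>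

lemma card_lists_distinct_images:
  assumes "finite Z" and fibre: "\<And>y. y \<in> f ` Z \<Longrightarrow> card {z \<in> Z. f z = y} = l"
  shows "card {zs. length zs = h \<and> set zs \<subseteq> Z \<and> distinct (map f zs)}
    = (\<Prod>i<h. (card (f ` Z) - i) * l)"
proof (induction h)
  case 0
  have "{zs. length zs = 0 \<and> set zs \<subseteq> Z \<and> distinct (map f zs)} = {[]}"
    by auto
  then show ?case
    by simp
next
  case (Suc h)
  let ?S = "\<lambda>h. {zs. length zs = h \<and> set zs \<subseteq> Z \<and> distinct (map f zs)}"
  let ?W = "\<lambda>zs. {z \<in> Z. f z \<notin> f ` set zs}"
  have fin: "finite (?S h)"
    by (rule finite_subset[OF _ finite_lists_length_eq[OF assms(1), of h]]) auto
  have card_W: "card (?W zs) = (card (f ` Z) - h) * l" if "zs \<in> ?S h" for zs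
  proof -
    have "?W zs = (\<Union>y\<in>f ` Z - f ` set zs. {z \<in> Z. f z = y})"
      (is "_ = ?U")
    proof (intro set_eqI iffI)
      fix z assume "z \<in> ?W zs"
      then show "z \<in> ?U"
        by (intro UN_I[of "f z"]) simp_all
    next
      fix z assume "z \<in> ?U"
      then show "z \<in> ?W zs"
        by (elim UN_E) simp
    qed
    also have "card \<dots> = (\<Sum>y\<in>f ` Z - f ` set zs. card {z \<in> Z. f z = y})"
      by (rule card_UN_disjoint) (use assms(1) in auto)
    also have "\<dots> = card (f ` Z - f ` set zs) * l"
      by (simp add: fibre)
    also have "card (f ` Z - f ` set zs) = card (f ` Z) - card (f ` set zs)"
      using that by (intro card_Diff_subset) auto
    also have "card (f ` set zs) = h"
      using that distinct_card[of "map f zs"] by simp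
    finally show ?thesis .
  qed
  have "bij_betw (\<lambda>(zs, z). z # zs) (SIGMA zs:?S h. ?W zs) (?S (Suc h))"
    by (rule bij_betw_imageI) (force simp: inj_on_def length_Suc_conv image_iff)+
  then have "card (?S (Suc h)) = card (SIGMA zs:?S h. ?W zs)"
    by (simp add: bij_betw_same_card)
  also have "\<dots> = (\<Sum>zs\<in>?S h. card (?W zs))"
    using fin assms(1) by simp
  also have "\<dots> = card (?S h) * ((card (f ` Z) - h) * l)"
    using card_W by simp
  finally show ?case
    unfolding Suc prod.lessThan_Suc .
qed

section \<open>Cycle types as exponent vectors\<close>

definition orbit_type :: "('a \<Rightarrow> 'a) \<Rightarrow> 'a set \<Rightarrow> nat \<Rightarrow>\<^sub>0 nat" where
  "orbit_type \<sigma> A = (\<Sum>C\<in>orbit \<sigma> ` A. Poly_Mapping.single (card C) 1)"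

lemma lookup_orbit_type:
  assumes "finite A"
  shows "Poly_Mapping.lookup (orbit_type \<sigma> A) i = card {C \<in> orbit \<sigma> ` A. card C = i}"
  using assms
  by (simp add: orbit_type_def lookup_sum lookup_single when_def sum.If_cases Int_def)

text \<open>Each entry of \<open>ys\<close> accounts for one deleted cycle of length
  \<open>l\<close>. The additive form avoids truncated subtraction; the difference follows by
  cancellation.\<close>

lemma orbit_type_Diff:
  assumes "permutation \<sigma>" "finite A" "set ys \<subseteq> A" "distinct (map (orbit \<sigma>) ys)"
    and "\<And>y. y \<in> set ys \<Longrightarrow> card (orbit \<sigma> y) = l"
  shows "orbit_type \<sigma> (A - \<Union> (orbit \<sigma> ` set ys)) + Poly_Mapping.single l (length ys)
    = orbit_type \<sigma> A"
proof -
  let ?B = "\<Union> (orbit \<sigma> ` set ys)"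
  have mem: "z \<in> ?B \<longleftrightarrow> orbit \<sigma> z \<in> orbit \<sigma> ` set ys" for z
    using orbit_eq_if_mem[OF assms(1)] permutation_self_in_orbit[OF assms(1)]
    by (smt (verit) UN_iff imageE image_eqI)
  have "orbit \<sigma> ` A = orbit \<sigma> ` (A - ?B) \<union> orbit \<sigma> ` set ys"
    using mem assms(3) by blast
  moreover have "orbit \<sigma> ` (A - ?B) \<inter> orbit \<sigma> ` set ys = {}"
    using mem by blast
  ultimately have "orbit_type \<sigma> A = orbit_type \<sigma> (A - ?B)
      + (\<Sum>C\<in>orbit \<sigma> ` set ys. Poly_Mapping.single (card C) 1)"
    unfolding orbit_type_def using assms(2) by (simp add: sum.union_disjoint)
  also have "(\<Sum>C\<in>orbit \<sigma> ` set ys. Poly_Mapping.single (card C) 1)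
      = (\<Sum>C\<in>orbit \<sigma> ` set ys. Poly_Mapping.single l (1::nat))"
    using assms(5) by (intro sum.cong) auto
  also have "\<dots> = Poly_Mapping.single l (card (orbit \<sigma> ` set ys))"
    by (rule poly_mapping_eqI) (simp only: lookup_sum lookup_single, simp add: when_def)
  also have "card (orbit \<sigma> ` set ys) = length ys"
    using distinct_card[OF assms(4)] by simp
  finally show ?thesis
    by simp
qed

text \<open>Roots are sorted by the \<open>g\<close> belonging to the cycle of \<open>x\<close>,
  then by the first \<open>g\<close> points of that cycle. The product counts the admissible initial
  segments, and \<open>IH\<close> counts the roots on what remains. For \<open>g\<close> above the
  number of \<sigma>-cycles of length \<open>l\<close> the product is zero, so the truncated
  difference does no harm.\<close>

lemma card_local_roots_rec:
  fixes \<sigma> :: "'a \<Rightarrow> 'a" and N :: "(nat \<Rightarrow>\<^sub>0 nat) \<Rightarrow> rat"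
  assumes m: "0 < m" and \<sigma>: "permutation \<sigma>" and A: "finite A" "\<sigma> ` A \<subseteq> A" and x: "x \<in> A"
    and IH: "\<And>D. D \<subset> A \<Longrightarrow> \<sigma> ` D \<subseteq> D \<Longrightarrow> of_nat (card (local_roots m \<sigma> D)) = N (orbit_type \<sigma> D)"
  defines "l \<equiv> card (orbit \<sigma> x)"
  shows "of_nat (card (local_roots m \<sigma> A)) = (\<Sum>g\<in>G_set m l.
    (\<Prod>i<g - 1. of_nat ((Poly_Mapping.lookup (orbit_type \<sigma> A) l - 1 - i) * l))
      * N (orbit_type \<sigma> A - Poly_Mapping.single l g))"
proof -
  let ?orb = "orbit \<sigma>" and ?R = "local_roots m \<sigma>" and ?ty = "orbit_type \<sigma> A"
  have self: "z \<in> ?orb z" for z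
    using \<sigma> by (rule permutation_self_in_orbit)
  have orb_eq: "?orb z = ?orb y" if "z \<in> ?orb y" for z y
    using \<sigma> that by (rule orbit_eq_if_mem)
  have orb_A: "?orb z \<subseteq> A" if "z \<in> A" for z
  proof
    fix y assume "y \<in> ?orb z"
    then show "y \<in> A"
      by induction (use A(2) that in auto)
  qed
  have l: "0 < l"
    unfolding l_def using \<sigma> by (rule card_orbit_pos)
  \<comment> \<open>The points that may follow \<open>x\<close> in an initial segment; excluding the
    cycle of \<open>x\<close> itself produces the \<open>- 1\<close> in the product.\<close>
  define Z where "Z = {z \<in> A. card (?orb z) = l \<and> ?orb z \<noteq> ?orb x}"
  have finite_Z: "finite Z"
    using A(1) by (simp add: Z_def)
  have fibre_Z: "card {z \<in> Z. ?orb z = C} = l" if C: "C \<in> ?orb ` Z" for C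
  proof -
    obtain y where y: "y \<in> Z" "C = ?orb y"
      using C by blast
    have "{z \<in> Z. ?orb z = C} = C"
    proof (intro set_eqI iffI)
      fix z assume "z \<in> {z \<in> Z. ?orb z = C}"
      then show "z \<in> C"
        using self by blast
    next
      fix z assume "z \<in> C"
      then have "?orb z = C"
        unfolding y(2) by (rule orb_eq)
      moreover have "z \<in> A"
        using \<open>z \<in> C\<close> y orb_A[of y] by (auto simp: Z_def)
      ultimately show "z \<in> {z \<in> Z. ?orb z = C}"
        using y by (simp add: Z_def)
    qed
    with y show ?thesis
      by (simp add: Z_def)
  qed
  have "?orb ` Z = {C \<in> ?orb ` A. card C = l} - {?orb x}"
    by (auto simp: Z_def)
  then have card_Z: "card (?orb ` Z) = Poly_Mapping.lookup ?ty l - 1"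
    using x A(1) by (simp add: lookup_orbit_type l_def)
  define Rg where "Rg g = {\<tau> \<in> ?R A. card (orbit \<tau> x) = g * l}" for g
  define L where "L g = {ys. length ys = g \<and> set ys \<subseteq> {y \<in> A. card (?orb y) = l}
    \<and> distinct (map ?orb ys) \<and> hd ys = x}" for g
  define path where "path g \<tau> = map (\<lambda>i. (\<tau> ^^ i) x) [0..<g]" for g and \<tau> :: "'a \<Rightarrow> 'a"
  have finite_R: "finite (?R A)"
    using A(1) by (rule finite_local_roots)
  have L_eq: "L g = (#) x ` {zs. length zs = g - 1 \<and> set zs \<subseteq> Z \<and> distinct (map ?orb zs)}"
    if "0 < g" for g
  proof (intro subset_antisym subsetI)
    fix ys assume ys: "ys \<in> L g"
    then obtain zs where zs: "ys = x # zs"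
      using \<open>0 < g\<close> by (cases ys) (auto simp: L_def)
    have "zs \<in> {zs. length zs = g - 1 \<and> set zs \<subseteq> Z \<and> distinct (map ?orb zs)}"
      using ys unfolding zs L_def Z_def by auto
    then show "ys \<in> (#) x ` {zs. length zs = g - 1 \<and> set zs \<subseteq> Z \<and> distinct (map ?orb zs)}"
      unfolding zs by (rule imageI)
  next
    fix ys assume "ys \<in> (#) x ` {zs. length zs = g - 1 \<and> set zs \<subseteq> Z \<and> distinct (map ?orb zs)}"
    then obtain zs where zs: "ys = x # zs" "length zs = g - 1" "set zs \<subseteq> Z" "distinct (map ?orb zs)"
      by blast
    moreover have "?orb x \<notin> ?orb ` set zs"
      using zs(3) by (auto simp: Z_def)
    ultimately show "ys \<in> L g"
      using that x by (auto simp: L_def Z_def l_def)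
  qed
  have card_L: "card (L g) = (\<Prod>i<g - 1. (Poly_Mapping.lookup ?ty l - 1 - i) * l)" if "0 < g" for g
    unfolding L_eq[OF that] card_Z[symmetric]
    by (simp add: card_image card_lists_distinct_images[OF finite_Z fibre_Z])
  have finite_L: "finite (L g)" if "0 < g" for g
    by (rule finite_subset[OF _ finite_lists_length_eq[OF A(1), of g]]) (auto simp: L_def)
  have fibre: "of_nat (card {\<tau> \<in> Rg g. path g \<tau> = ys}) = N (?ty - Poly_Mapping.single l g)"
    if g: "g \<in> G_set m l" and ys: "ys \<in> L g" for g ys
  proof -
    define D where "D = A - \<Union> (?orb ` set ys)"
    have ys': "length ys = g" "distinct (map ?orb ys)" "\<And>y. y \<in> set ys \<Longrightarrow> card (?orb y) = l"
      "set ys \<subseteq> A" "hd ys = x"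
      using ys by (auto simp: L_def)
    have "ys \<noteq> []"
      using ys'(1) g by (auto simp: G_set_def)
    then have "x \<notin> D"
      using ys'(5) self hd_in_set unfolding D_def by blast
    then have "D \<subset> A"
      using x by (auto simp: D_def)
    moreover have "\<sigma> ` D \<subseteq> D"
    proof -
      \<comment> \<open>Orbits are closed under preimages as well, so deleting whole \<sigma>-cycles
        leaves an invariant set.\<close>
      have "z \<in> ?orb y" if "\<sigma> z \<in> ?orb y" for z y
        using orb_eq[OF that] permutation_orbit_step[OF \<sigma>, of z] self by metis
      then show ?thesis
        using A(2) unfolding D_def by blast
    qed
    ultimately have "of_nat (card (?R D)) = N (orbit_type \<sigma> D)"
      by (rule IH)
    also have "orbit_type \<sigma> D = ?ty - Poly_Mapping.single l g"
      using orbit_type_Diff[OF \<sigma> A(1) ys'(4,2,3)] ys'(1)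
      by (metis D_def add_diff_cancel_right')
    moreover have "\<Union> (?orb ` set ys) \<subseteq> A"
      using orb_A ys'(4) by blast
    then have "card {\<tau> \<in> Rg g. path g \<tau> = ys} = card (?R D)"
      unfolding D_def Rg_def path_def mem_Collect_eq conj_assoc
      by (intro card_local_roots_fibre[OF \<sigma> A(1) g ys'(1,2) _ x ys'(5) refl] ys'(3))
    ultimately show ?thesis
      by simp
  qed
  have path_L: "path g \<tau> \<in> L g" if g: "g \<in> G_set m l" and \<tau>: "\<tau> \<in> Rg g" for g \<tau>
  proof -
    have \<tau>': "\<tau> \<in> ?R A" "card (orbit \<tau> x) = g * l" "\<tau> permutes A" "permutation \<tau>"
      using \<tau> A(1) by (auto simp: Rg_def local_roots_def permutation_permutes)
    have g': "0 < g" "gcd (g * l) m = g"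
      using g by (auto simp: G_set_def)
    then have g_dvd: "g dvd m"
      by (metis gcd_dvd2)
    have mem: "(\<tau> ^^ i) x \<in> A" for i
      using \<tau>'(3) x by (rule funpow_mem_permutes)
    have "card (?orb ((\<tau> ^^ i) x)) = l" for i
      using local_root_orbit_card[OF \<sigma> A(1) \<tau>'(1) mem, of i] g' \<tau>'(2,4) by simp
    moreover have "distinct (map ?orb (path g \<tau>))"
    proof -
      \<comment> \<open>Points on one \<sigma>-cycle differ by a power of \<open>\<sigma>\<close>,
        that is, by a multiple of \<open>m\<close> in the exponent of \<open>\<tau>\<close>. As
        \<open>g\<close> divides both \<open>m\<close> and the cycle length, \<open>i\<close> and
        \<open>j\<close> agree modulo \<open>g\<close>.\<close>
      have "i = j" if "?orb ((\<tau> ^^ i) x) = ?orb ((\<tau> ^^ j) x)" "i < g" "j < g" for i j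
      proof -
        have "(\<tau> ^^ i) x \<in> ?orb ((\<tau> ^^ j) x)"
          using self[of "(\<tau> ^^ i) x"] unfolding that(1) .
        then obtain q where "(\<tau> ^^ i) x = (\<sigma> ^^ q) ((\<tau> ^^ j) x)"
          unfolding orbit_altdef_permutation[OF \<sigma>] by blast
        then have "(\<tau> ^^ i) x = (\<tau> ^^ (m * q + j)) x"
          using local_root_funpow[OF \<tau>'(1) mem] by (simp add: funpow_add)
        then have "[i = m * q + j] (mod g * l)"
          by (simp add: funpow_eq_iff_cong[OF \<tau>'(4)] \<tau>'(2))
        then have "[i = m * q + j] (mod g)"
          by (rule cong_dvd_modulus_nat) simp
        with g_dvd that show ?thesis
          by (auto simp: cong_def mult.assoc)
      qed
      then show ?thesis
        by (auto simp: path_def distinct_map inj_on_def)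
    qed
    ultimately show ?thesis
      using g'(1) mem by (auto simp: L_def path_def hd_map)
  qed
  have card_Rg: "of_nat (card (Rg g)) = of_nat (card (L g)) * N (?ty - Poly_Mapping.single l g)"
    if g: "g \<in> G_set m l" for g
  proof -
    have g0: "0 < g"
      using g by (simp add: G_set_def)
    have "Rg g = (\<Union>ys\<in>L g. {\<tau> \<in> Rg g. path g \<tau> = ys})"
      using path_L[OF g] by auto
    also have "card \<dots> = (\<Sum>ys\<in>L g. card {\<tau> \<in> Rg g. path g \<tau> = ys})"
      by (rule card_UN_disjoint) (use finite_L[OF g0] finite_R in \<open>auto simp: Rg_def\<close>)
    finally show ?thesis
      using fibre[OF g] by simp
  qed
  have "?R A = (\<Union>g\<in>G_set m l. Rg g)"
  proof -
    have "\<tau> \<in> (\<Union>g\<in>G_set m l. Rg g)" if \<tau>: "\<tau> \<in> ?R A" for \<tau>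
    proof -
      define g where "g = gcd (card (orbit \<tau> x)) m"
      have "card (orbit \<tau> x) = g * l"
        using local_root_orbit_card[OF \<sigma> A(1) \<tau> x] by (simp add: g_def l_def)
      moreover from this have "g \<in> G_set m l"
        using m by (simp add: G_set_def g_def)
      ultimately show ?thesis
        using \<tau> by (auto simp: Rg_def)
    qed
    then show ?thesis
      by (auto simp: Rg_def)
  qed
  \<comment> \<open>The union is disjoint because \<open>l\<close> is positive, so the length
    \<open>g * l\<close> determines \<open>g\<close>.\<close>
  also have "card \<dots> = (\<Sum>g\<in>G_set m l. card (Rg g))"
    by (rule card_UN_disjoint)
      (use finite_G_set[OF m] finite_R l in \<open>auto simp: Rg_def\<close>)
  finally have "of_nat (card (?R A)) = (\<Sum>g\<in>G_set m l. (of_nat (card (Rg g)) :: rat))"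
    by simp
  also have "\<dots> = (\<Sum>g\<in>G_set m l. (\<Prod>i<g - 1. of_nat ((Poly_Mapping.lookup ?ty l - 1 - i) * l))
      * N (?ty - Poly_Mapping.single l g))"
    by (intro sum.cong refl) (simp add: card_Rg card_L G_set_def)
  finally show ?thesis .
qed

section \<open>Factorial weights and comparison of the two recurrences\<close>

definition monom_fact :: "('v \<Rightarrow>\<^sub>0 nat) \<Rightarrow> rat" where
  "monom_fact x = (\<Prod>v\<in>Poly_Mapping.keys x. fact (Poly_Mapping.lookup x v))"

lemma monom_fact_superset:
  assumes "finite K" "Poly_Mapping.keys x \<subseteq> K"
  shows "monom_fact x = (\<Prod>v\<in>K. fact (Poly_Mapping.lookup x v))"
  unfolding monom_fact_def using assms by (intro prod.mono_neutral_left) (auto simp: in_keys_iff)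

text \<open>Only the factor at \<open>v\<close> changes. The identity is cross-multiplied so that no
  quotient of factorials occurs.\<close>

lemma monom_fact_diff_single:
  assumes "g \<le> Poly_Mapping.lookup x v"
  shows "monom_fact x * fact (Poly_Mapping.lookup x v - g)
    = monom_fact (x - Poly_Mapping.single v g) * fact (Poly_Mapping.lookup x v)"
proof -
  let ?K = "insert v (Poly_Mapping.keys x)" and ?y = "x - Poly_Mapping.single v g"
  have lookup_y: "Poly_Mapping.lookup ?y u = Poly_Mapping.lookup x u - (if u = v then g else 0)" for u
    by (simp add: lookup_minus lookup_single when_def)
  have "Poly_Mapping.keys ?y \<subseteq> ?K"
    by (auto simp: in_keys_iff lookup_minus)
  then have "monom_fact ?y = (\<Prod>u\<in>?K. fact (Poly_Mapping.lookup ?y u))"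
    by (intro monom_fact_superset) auto
  also have "\<dots> = fact (Poly_Mapping.lookup x v - g)
      * (\<Prod>u\<in>?K - {v}. fact (Poly_Mapping.lookup x u))"
    by (subst prod.remove[of _ v]) (simp_all add: lookup_y)
  finally have y: "monom_fact ?y = \<dots>" .
  have "monom_fact x = (\<Prod>u\<in>?K. fact (Poly_Mapping.lookup x u))"
    by (intro monom_fact_superset) auto
  also have "\<dots> = fact (Poly_Mapping.lookup x v)
      * (\<Prod>u\<in>?K - {v}. fact (Poly_Mapping.lookup x u))"
    by (subst prod.remove[of _ v]) auto
  finally show ?thesis
    unfolding y by simp
qed

lemma prod_falling_fact:
  assumes "h \<le> n"
  shows "(\<Prod>i<h. of_nat (n - i)) * fact (n - h) = (fact n :: 'a :: {semiring_char_0, comm_semiring_1})"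
  using assms
proof (induction h)
  case (Suc h)
  then have "fact (n - h) = of_nat (n - h) * (fact (n - Suc h) :: 'a)"
    by (subst fact_reduce) (simp_all add: Suc_diff_Suc)
  with Suc show ?case
    by (simp add: mult.assoc)
qed simp

text \<open>The coefficient recurrence is multiplied by \<open>monom_fact x\<close> and divided by
  the exponent of \<open>l\<close>; the quotients of factorials become falling products, in the
  shape of \<open>card_local_roots_rec\<close>.\<close>

lemma monom_fact_exp_root_exponent_rec:
  fixes x :: "nat \<Rightarrow>\<^sub>0 nat"
  assumes m: "0 < m" and l: "0 < l" and a: "0 < Poly_Mapping.lookup x l"
  defines "N \<equiv> \<lambda>y. mfps_coeff (mfps_exp (root_exponent m)) y * monom_fact y"
  shows "N x = (\<Sum>g\<in>G_set m l.
    (\<Prod>i<g - 1. of_nat ((Poly_Mapping.lookup x l - 1 - i) * l)) * N (x - Poly_Mapping.single l g))"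
proof -
  let ?a = "Poly_Mapping.lookup x l" and ?G = "{g \<in> G_set m l. g \<le> Poly_Mapping.lookup x l}"
  let ?E = "mfps_coeff (mfps_exp (root_exponent m))" and ?s = "Poly_Mapping.single l"
  have fact_a: "fact ?a = of_nat ?a * (fact (?a - 1) :: rat)"
    using a by (rule fact_reduce)
  have summand: "of_nat l ^ (g - 1) * ?E (x - ?s g) * monom_fact x
      = of_nat ?a * ((\<Prod>i<g - 1. of_nat ((?a - 1 - i) * l)) * N (x - ?s g))"
    if g: "g \<in> ?G" for g
  proof -
    have g': "0 < g" "g \<le> ?a"
      using g by (auto simp: G_set_def)
    then have "?a - 1 - (g - 1) = ?a - g"
      by simp
    with prod_falling_fact[of "g - 1" "?a - 1", where 'a = rat] g'
    have falling: "fact (?a - 1) = (\<Prod>i<g - 1. of_nat (?a - 1 - i)) * (fact (?a - g) :: rat)"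
      by simp
    have "monom_fact x * fact (?a - g)
        = of_nat ?a * (\<Prod>i<g - 1. of_nat (?a - 1 - i)) * monom_fact (x - ?s g) * fact (?a - g)"
      unfolding monom_fact_diff_single[OF g'(2)] fact_a falling by (simp only: mult_ac)
    then have "monom_fact x = of_nat ?a * (\<Prod>i<g - 1. of_nat (?a - 1 - i)) * monom_fact (x - ?s g)"
      by simp
    moreover have "(\<Prod>i<g - 1. of_nat ((?a - 1 - i) * l))
        = (\<Prod>i<g - 1. of_nat (?a - 1 - i)) * (of_nat l :: rat) ^ (g - 1)"
      by (simp add: prod.distrib)
    ultimately show ?thesis
      by (simp only: N_def mult_ac)
  qed
  have "of_nat ?a * N x = (\<Sum>g\<in>?G. of_nat l ^ (g - 1) * ?E (x - ?s g) * monom_fact x)"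
    unfolding N_def mult.assoc[symmetric] coeff_exp_root_exponent_rec[OF m l] sum_distrib_right ..
  also have "\<dots> = of_nat ?a * (\<Sum>g\<in>?G. (\<Prod>i<g - 1. of_nat ((?a - 1 - i) * l)) * N (x - ?s g))"
    unfolding sum_distrib_left using summand by (rule sum.cong[OF refl])
  finally have "N x = (\<Sum>g\<in>?G. (\<Prod>i<g - 1. of_nat ((?a - 1 - i) * l)) * N (x - ?s g))"
    using a by simp
  also have "\<dots> = (\<Sum>g\<in>G_set m l. (\<Prod>i<g - 1. of_nat ((?a - 1 - i) * l)) * N (x - ?s g))"
  proof (rule sum.mono_neutral_left)
    show "\<forall>g\<in>G_set m l - ?G. (\<Prod>i<g - 1. of_nat ((?a - 1 - i) * l)) * N (x - ?s g) = 0"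
    proof
      \<comment> \<open>For \<open>g > ?a\<close> the product contains the index
        \<open>?a - 1\<close>, whose factor is zero; this lets the sum extend to all of
        \<open>G_set m l\<close>.\<close>
      fix g assume "g \<in> G_set m l - ?G"
      then have "?a - 1 \<in> {..<g - 1}"
        using a by auto
      then have "(\<Prod>i<g - 1. of_nat ((?a - 1 - i) * l)) = (0 :: rat)"
        by (intro prod_zero) (auto intro!: bexI[of _ "?a - 1"])
      then show "(\<Prod>i<g - 1. of_nat ((?a - 1 - i) * l)) * N (x - ?s g) = 0"
        by simp
    qed
  qed (use finite_G_set[OF m] in auto)
  finally show ?thesis .
qed

text \<open>Strong induction on \<open>A\<close>, matching both recurrences at the cycle length of
  any point of \<open>A\<close>. On the empty set the only root is \<open>id\<close>, and the
  exponential has constant term 1.\<close>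

lemma card_local_roots:
  assumes m: "0 < m" and \<sigma>: "permutation \<sigma>" and A: "finite A" "\<sigma> ` A \<subseteq> A"
  shows "of_nat (card (local_roots m \<sigma> A))
    = mfps_coeff (mfps_exp (root_exponent m)) (orbit_type \<sigma> A) * monom_fact (orbit_type \<sigma> A)"
  using A
proof (induction A rule: finite_psubset_induct)
  case (psubset A)
  show ?case
  proof (cases "A = {}")
    case True
    have "local_roots m \<sigma> {} = {id}"
      by (auto simp: local_roots_def)
    moreover have "mfps_coeff (mfps_exp (root_exponent m)) 0 = 1"
      using mfps_coeff_exp[OF root_exponent_coeff_0, of 0 1] by (simp add: mfps_coeff_one)
    ultimately show ?thesis
      using True by (simp add: orbit_type_def monom_fact_def)
  next
    case False
    then obtain x where x: "x \<in> A"
      by blast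
    have "0 < Poly_Mapping.lookup (orbit_type \<sigma> A) (card (orbit \<sigma> x))"
      using x psubset.hyps by (auto simp: lookup_orbit_type card_gt_0_iff)
    from monom_fact_exp_root_exponent_rec[OF m card_orbit_pos[OF \<sigma>] this] show ?thesis
      by (subst card_local_roots_rec[OF m \<sigma> psubset.hyps psubset.prems x psubset.IH]) simp_all
  qed
qed

theorem theorem2:
  fixes m n :: nat and a :: "nat \<Rightarrow> nat" and \<sigma> :: "nat \<Rightarrow> nat"
  assumes "0 < m" and "0 < n"
    and "n = (\<Sum>i=1..n. i * a i)"
    and "\<sigma> permutes {1..n}" and "has_cycle_type n \<sigma> a"
  shows "mfps_coeff (mfps_exp (root_exponent m)) (\<Sum>i=1..n. Poly_Mapping.single i (a i))
           * (\<Prod>i=1..n. fact (a i))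
         = of_nat (card (perm_roots m n \<sigma>))"
proof -
  let ?A = "{1..n}" and ?x = "\<Sum>i=1..n. Poly_Mapping.single i (a i)"
  have \<sigma>: "permutation \<sigma>"
    using assms(4) by (auto simp: permutation_permutes)
  have lookup_x: "Poly_Mapping.lookup ?x i = (if i \<in> ?A then a i else 0)" for i
    by (simp add: lookup_sum lookup_single when_def)
  \<comment> \<open>Outside \<open>?A\<close> both sides are the identity, so local roots on
    \<open>?A\<close> are roots in the global sense.\<close>
  have "\<tau> ^^ m = \<sigma>" if "\<tau> permutes ?A" "\<forall>z\<in>?A. (\<tau> ^^ m) z = \<sigma> z" for \<tau>
  proof
    fix z
    show "(\<tau> ^^ m) z = \<sigma> z"
    proof (cases "z \<in> ?A")
      case False
      then have "(\<tau> ^^ m) z = z"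
        using permutes_not_in[OF that(1)] by (induction m) auto
      with False show ?thesis
        using permutes_not_in[OF assms(4)] by simp
    qed (use that in auto)
  qed
  then have roots: "perm_roots m n \<sigma> = local_roots m \<sigma> ?A"
    by (auto simp: perm_roots_def local_roots_def)
  have "orbit_type \<sigma> ?A = ?x"
  proof (rule poly_mapping_eqI)
    fix i
    \<comment> \<open>\<open>has_cycle_type\<close> speaks only of lengths from 1 to
      \<open>n\<close>; no other length occurs, since orbits are nonempty subsets of
      \<open>?A\<close>.\<close>
    have "card (orbit \<sigma> y) \<in> ?A" if "y \<in> ?A" for y
      using card_mono[OF _ permutes_orbit_subset[OF assms(4) that]] card_orbit_pos[OF \<sigma>, of y]
      by (simp add: Suc_le_eq)
    then have "{C \<in> orbit \<sigma> ` ?A. card C = i} = {}" if "i \<notin> ?A"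
      using that by blast
    then show "Poly_Mapping.lookup (orbit_type \<sigma> ?A) i = Poly_Mapping.lookup ?x i"
      using assms(5) unfolding lookup_x by (auto simp: lookup_orbit_type has_cycle_type_def)
  qed
  moreover have "monom_fact ?x = (\<Prod>i=1..n. fact (a i))"
  proof -
    have keys: "Poly_Mapping.keys ?x \<subseteq> ?A"
      using lookup_x by (auto simp: in_keys_iff split: if_splits)
    show ?thesis
      unfolding monom_fact_superset[OF finite_atLeastAtMost keys] lookup_x by (intro prod.cong) auto
  qed
  ultimately show ?thesis
    using card_local_roots[OF assms(1) \<sigma>, of ?A] permutes_image[OF assms(4)] by (simp add: roots)
qed

end
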